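(* There is a power series $H_{BW}(x)\in\mathbb{Z}[[x]]$ such that $$\lim_{k\to\infty}\mathcal{D}_{(BW)^k}(x)=H_{BW}(x)$$ (coefficient-wise convergence). Moreover, $H_{BW}(x)$ is a rational function, given by $$H_{BW}(x)=\frac{(x-1)^2(3x+2)}{x^3-3x^2-x+1}=2+x+3x^2+7x^3+15x^4+33x^5+71x^6+155x^7+335x^8+\cdots.$$
   Context: For a positive integer $n$, the Bulgarian Solitaire map $\beta$ acts on the set $\mathcal{P}(n)$ of integer partitions of $n$: given $\lambda=(\lambda_1\ge\dots\ge\lambda_\ell>0)$, subtract $1$ from each of the $\ell$ parts, add a new part equal to $\ell$, discard zero parts, and sort into weakly decreasing order. The orbits of $\beta$ are the weakly connected components of the directed graph on $\mathcal{P}(n)$ with edges $\lambda\to\beta(\lambda)$; each contains a unique recurrent cycle, consisting of those $\lambda$ with $\beta^m(\lambda)=\lambda$ for some $m\ge 1$. A necklace is an equivalence class of finite words in the letters $\{B,W\}$ under cyclic rotation; a $0/1$-vector encodes a necklace $N$ if replacing $1$ by $B$ and $0$ by $W$ gives a word in the class $N$. $P^k$ denotes the concatenation of $k$ copies of $P$, so $(BW)^k=BWBW\cdots BW$ has length $2k$. By a theorem of Brandt, to each necklace $N$ of length $m$ corresponds an orbit $\mathcal{O}_N$ of $\beta$ on $\mathcal{P}(n)$, where $n=\binom{m}{2}+\#\{\text{black beads of }N\}$: its recurrent cycle $C_N$ consists of exactly the partitions $\lambda$ (padded with zeros to length $m$) for which $\lambda-(m-1,m-2,\dots,1,0)$ is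 a $0/1$-vector encoding $N$. Thus $\mathcal{O}_N$ is the set of all partitions of $n$ that eventually enter $C_N$ under iteration of $\beta$. For $\lambda\in\mathcal{O}_N$ let $\mathrm{level}(\lambda)=\min\{m\in\{0,1,2,\dots\}:\beta^m(\lambda)\in C_N\}$, and let $\mathcal{D}_N(x)=\sum_{\lambda\in\mathcal{O}_N}x^{\mathrm{level}(\lambda)}\in\mathbb{Z}[x]$. *)

theory Defs
  imports "HOL-Computational_Algebra.Computational_Algebra"
begin

section \<open>Partitions and the Bulgarian Solitaire map\<close>

definition partitions :: "nat \<Rightarrow> nat list set" where
  "partitions n = {xs. sorted_wrt (\<ge>) xs \<and> (\<forall>x\<in>set xs. 0 < x) \<and> sum_list xs = n}"

definition bulgarian :: "nat list \<Rightarrow> nat list" where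
  "bulgarian xs = rev (sort (filter (\<lambda>x. 0 < x) (length xs # map (\<lambda>x. x - 1) xs)))"

section \<open>Necklaces\<close>

datatype bead = Black | White

definition rotation_equiv :: "bead list \<Rightarrow> bead list \<Rightarrow> bool" where
  "rotation_equiv u v \<longleftrightarrow> (\<exists>i. v = rotate i u)"

lemma rotation_equiv_sym:
  assumes "rotation_equiv u v"
  shows "rotation_equiv v u"
proof -
  from assms obtain i where v: "v = rotate i u"
    by (auto simp: rotation_equiv_def)
  have "rotate (length u - i mod length u) (rotate i u) = u"
  proof (cases "u = []")
    case False
    have "(length u - i mod length u + i) mod length u
        = (length u - i mod length u + i mod length u) mod length u"
      by (simp only: mod_add_right_eq)
    also have "\<dots> = 0"
      using False by (simp add: less_imp_le)
    finally show ?thesis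
      by (metis rotate_rotate rotate_conv_mod rotate0 id_apply)
  qed simp
  then show ?thesis
    unfolding rotation_equiv_def v by metis
qed

lemma equivp_rotation_equiv: "equivp rotation_equiv"
proof (rule equivpI)
  show "reflp rotation_equiv"
    by (rule reflpI) (metis rotation_equiv_def rotate0 id_apply)
  show "symp rotation_equiv"
    by (rule sympI) (rule rotation_equiv_sym)
  show "transp rotation_equiv"
    by (rule transpI) (auto simp: rotation_equiv_def rotate_rotate)
qed

quotient_type necklace = "bead list" / rotation_equiv
  morphisms rep_necklace necklace_of_word
  by (rule equivp_rotation_equiv)

lift_definition necklace_length :: "necklace \<Rightarrow> nat" is length
  by (auto simp: rotation_equiv_def)

lemma count_list_rotate: "count_list (rotate i w) b = count_list w b"
proof (induction i)
  case (Suc i)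
  have "count_list (rotate1 v) b = count_list v b" for v
    by (cases v) auto
  with Suc show ?case by simp
qed simp

lift_definition black_beads :: "necklace \<Rightarrow> nat" is "\<lambda>w. count_list w Black"
  by (auto simp: rotation_equiv_def count_list_rotate)

definition word_power :: "bead list \<Rightarrow> nat \<Rightarrow> bead list" where
  "word_power P k = concat (replicate k P)"

definition bead_digit :: "bead \<Rightarrow> int" where
  "bead_digit b = (case b of Black \<Rightarrow> 1 | White \<Rightarrow> 0)"

definition encodes :: "int list \<Rightarrow> necklace \<Rightarrow> bool" where
  "encodes v N \<longleftrightarrow> (\<exists>w. v = map bead_digit w \<and> necklace_of_word w = N)"

section \<open>Orbits and their level generating functions\<close>

definition necklace_weight :: "necklace \<Rightarrow> nat" where
  "necklace_weight N = (necklace_length N choose 2) + black_beads N"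

definition pad_zeros :: "nat \<Rightarrow> nat list \<Rightarrow> nat list" where
  "pad_zeros m xs = xs @ replicate (m - length xs) 0"

text \<open>The list \<^term>\<open>rev [0..<m]\<close> is the staircase \<open>(m - 1, m - 2, ..., 1, 0)\<close>. The subtraction
  is carried out in the integers, because it would truncate on the natural numbers. The bound on
  the length is needed because \<^const>\<open>map2\<close> truncates to the shorter list.\<close>

definition recurrent_cycle :: "necklace \<Rightarrow> nat list set" where
  "recurrent_cycle N = {xs \<in> partitions (necklace_weight N).
     length xs \<le> necklace_length N \<and>
     encodes (map2 (\<lambda>a s. int a - int s) (pad_zeros (necklace_length N) xs)
                   (rev [0..<necklace_length N])) N}"

definition orbit :: "necklace \<Rightarrow> nat list set" where
  "orbit N = {xs \<in> partitions (necklace_weight N). \<exists>j. (bulgarian ^^ j) xs \<in> recurrent_cycle N}"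

definition level :: "necklace \<Rightarrow> nat list \<Rightarrow> nat" where
  "level N xs = (LEAST j. (bulgarian ^^ j) xs \<in> recurrent_cycle N)"

definition level_poly :: "necklace \<Rightarrow> int poly" where
  "level_poly N = (\<Sum>xs\<in>orbit N. monom 1 (level N xs))"

section \<open>Integer power series as rational power series\<close>

text \<open>Division of formal power series is only available over coefficient types with an inverse,
  so quotients of integer power series are taken over the rationals.\<close>

definition rat_fps_of_int_fps :: "int fps \<Rightarrow> rat fps" where
  "rat_fps_of_int_fps F = Abs_fps (\<lambda>i. of_int (fps_nth F i))"

end

theory Submission
  imports Defs
begin

text \<open>
  The idea is to play the solitaire backwards from the cycle and to record which parts are undone.

  A partition \<open>\<mu>\<close> is obtained from \<open>\<lambda>\<close> by playing once exactly when \<open>\<lambda>\<close> arises by removing from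
  \<open>\<mu>\<close> some part \<open>q\<close> with \<open>q + 1\<close> at least the number of parts of \<open>\<mu>\<close>, raising the remaining parts
  by one, and adding ones until there are \<open>q\<close> parts. So the predecessors of \<open>\<mu>\<close> correspond to its
  sufficiently large part sizes. The recurrent cycle of \<open>(BW)\<^sup>k\<close> consists of
  \<open>B = (2k-1, 2k-1, 2k-3, 2k-3, \<dots>, 1, 1)\<close> and \<open>A = (2k, 2k-2, 2k-2, \<dots>, 2, 2)\<close>, which are exchanged
  by the move, and \<open>A\<close> is the only predecessor of \<open>B\<close>.

  Going backwards from \<open>B\<close>, let the letter \<open>v\<close> stand for undoing a part that started as a copy of
  \<open>2k-1-2v\<close> in \<open>B\<close>. Each letter is available twice. Since undoing \<open>q\<close> leaves \<open>q\<close> parts while all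
  parts grow by one in each step, the next part may be smaller by at most one than its predecessor was when
  it was removed, which is a drop by two in terms of the original parts of \<open>B\<close>: a letter \<open>v\<close> may be
  followed by any letter up to \<open>v + 1\<close>, and the first letter must be \<open>0\<close>. The parts filled in as
  ones remain too small to be chosen during the first \<open>k\<close> steps. Hence for \<open>i \<le> k\<close> the positive
  multisets that reach \<open>B\<close> after exactly \<open>i\<close> moves are parametrised by words of length \<open>i\<close>
  (\<open>bij_betw_ancestor\<close>), and their number \<open>t\<^sub>i\<close> does not depend on \<open>k\<close>.

  A partition has level at most \<open>i\<close> iff it reaches \<open>B\<close> or \<open>A\<close> after \<open>i\<close> moves, and reaching \<open>A\<close>
  after \<open>i\<close> moves is the same as reaching \<open>B\<close> after \<open>i + 1\<close>. This gives \<open>t\<^sub>i + t\<^sub>i\<^sub>+\<^sub>1\<close> partitions of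
  level at most \<open>i\<close> (\<open>card_low_levels\<close>), and differences of these are the limit coefficients.

  For the generating function, cut a nonempty word at its occurrences of \<open>0\<close>, of which there are one or two.
  What lies between them is, after lowering all letters by one, a word again, or a pair of words that
  share the bound of two copies per letter. A pair of nonempty words starts with \<open>0\<close> in both
  components, so this uses up both copies of \<open>0\<close>, and deleting them leaves a pair of the same kind.
  With \<open>T\<close> and \<open>P\<close> the generating functions of words and of pairs, \<open>T = 1 + xT + x\<^sup>2P\<close> and
  \<open>P = 1 + 2(T-1) + x\<^sup>2P\<close>, so \<open>(1 - x - 3x\<^sup>2 + x\<^sup>3) T = 1 - 2x\<^sup>2\<close>; the denominator is the recurrence
  \<open>num_words_recurrence\<close>.
\<close>

section \<open>Slowly climbing words\<close>

text \<open>The words are written with the latest letter first, so that extending a word is consing: \<open>reach u\<close> is the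
  largest letter that may come next after the word \<open>u\<close>.\<close>

fun reach :: "nat list \<Rightarrow> nat" where
  "reach [] = 0"
| "reach (a # u) = Suc a"

fun slow :: "nat list \<Rightarrow> bool" where
  "slow [] \<longleftrightarrow> True"
| "slow (v # u) \<longleftrightarrow> v \<le> reach u \<and> slow u"

definition words :: "nat \<Rightarrow> nat list set" where
  "words n = {w. slow w \<and> (\<forall>v. count_list w v \<le> 2) \<and> length w = n}"

text \<open>The two components share the supply of two copies of each letter.\<close>

definition word_pairs :: "nat \<Rightarrow> (nat list \<times> nat list) set" where
  "word_pairs n = {(a, b). slow a \<and> slow b \<and> (\<forall>v. count_list a v + count_list b v \<le> 2) \<and>
     length a + length b = n}"

text \<open>After the letter \<open>0\<close> the next letter is at most \<open>1\<close>, which is the starting condition for a word whose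
  letters have been raised by one. So a word splits into independent words at each \<open>0\<close>.\<close>

lemma slow_map_Suc_append: "slow (map Suc a @ 0 # b) \<longleftrightarrow> slow a \<and> slow b"
proof (induction a)
  case (Cons x a)
  then show ?case by (cases a) auto
qed simp

text \<open>The first letter chosen, which is the last entry of the list, is forced to be \<open>0\<close>.\<close>

lemma slow_zero_mem: "slow w \<Longrightarrow> w \<noteq> [] \<Longrightarrow> 0 \<in> set w"
proof (induction w)
  case (Cons v u)
  then show ?case by (cases u) auto
qed simp

lemma top_le_length: "slow w \<Longrightarrow> reach w \<le> length w"
proof (induction w)
  case (Cons v u)
  then show ?case by simp
qed simp

lemma map_Suc_of_zero_notin: "0 \<notin> set w \<Longrightarrow> \<exists>a. w = map Suc a"
proof (induction w)
  case (Cons x w)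
  then obtain a where "w = map Suc a" by auto
  moreover obtain y where "x = Suc y" using Cons.prems by (cases x) auto
  ultimately have "x # w = map Suc (y # a)" by simp
  then show ?case by (rule exI)
qed simp

lemma slow_split:
  assumes "slow w" "w \<noteq> []"
  obtains a b where "w = map Suc a @ 0 # b" "slow a" "slow b"
proof -
  obtain pre b where w: "w = pre @ 0 # b" and "0 \<notin> set pre"
    using split_list_first[OF slow_zero_mem[OF assms]] by blast
  then obtain a where "pre = map Suc a" using map_Suc_of_zero_notin by blast
  with w assms(1) that show thesis by (auto simp: slow_map_Suc_append)
qed

lemma slow_single_zero:
  assumes "slow w" "w \<noteq> []" "count_list w 0 \<le> 1"
  obtains a where "w = map Suc a @ [0]" "slow a"
proof -
  obtain a b where w: "w = map Suc a @ 0 # b" "slow a" "slow b"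
    using slow_split[OF assms(1,2)] .
  then have "count_list b 0 = 0" using assms(3) by simp
  then have "b = []" using slow_zero_mem[OF w(3)] by (metis count_list_0_iff)
  then show thesis using w that by blast
qed

lemma count_map_Suc:
  "count_list (map Suc a) v = (case v of 0 \<Rightarrow> 0 | Suc v' \<Rightarrow> count_list a v')"
  by (induction a) (auto split: nat.splits)

lemma words_0: "words 0 = {[]}"
  by (auto simp: words_def)

lemma words_1: "words (Suc 0) = {[0]}"
  by (auto simp: words_def length_Suc_conv)

lemma word_pairs_0: "word_pairs 0 = {([], [])}"
  by (auto simp: word_pairs_def)

text \<open>The two sets in the union are the words with one and with two letters \<open>0\<close>. The final entry is always
  \<open>0\<close>, so a second one cuts the rest into a pair of words on the letters from \<open>1\<close> upwards.\<close>

lemma words_Suc_Suc: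
  "words (Suc (Suc n)) = (\<lambda>a. map Suc a @ [0]) ` words (Suc n) \<union>
     (\<lambda>(a, c). map Suc a @ 0 # map Suc c @ [0]) ` word_pairs n" (is "?L = ?R")
proof
  show "?L \<subseteq> ?R"
  proof
    fix w assume w: "w \<in> ?L"
    then have sl: "slow w" "w \<noteq> []" and cnt: "\<And>v. count_list w v \<le> 2"
      and len: "length w = Suc (Suc n)"
      by (auto simp: words_def)
    obtain a b where ab: "w = map Suc a @ 0 # b" "slow a" "slow b"
      using slow_split[OF sl] .
    show "w \<in> ?R"
    proof (cases "b = []")
      case True
      have "count_list a v \<le> 2" for v
        using cnt[of "Suc v"] ab True by (simp add: count_map_Suc)
      then have "a \<in> words (Suc n)" using ab True len by (simp add: words_def)
      then show ?thesis using ab True by auto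
    next
      case False
      have "count_list b 0 \<le> 1" using cnt[of 0] ab by (simp add: count_map_Suc)
      then obtain c where c: "b = map Suc c @ [0]" "slow c"
        using slow_single_zero[OF ab(3) False] by blast
      have "count_list a v + count_list c v \<le> 2" for v
        using cnt[of "Suc v"] ab c by (simp add: count_map_Suc)
      then have "(a, c) \<in> word_pairs n" using ab c len by (simp add: word_pairs_def)
      then show ?thesis using ab c by force
    qed
  qed
  show "?R \<subseteq> ?L"
    by (auto simp: words_def word_pairs_def slow_map_Suc_append count_map_Suc split: nat.splits)
qed

text \<open>If neither component is empty, each uses one copy of the letter \<open>0\<close> as its final entry, and the supply of
  \<open>0\<close> is exhausted. The remaining letters form a pair that is shorter by two.\<close>

lemma word_pairs_Suc:
  "word_pairs (Suc n) = Pair [] ` words (Suc n) \<union> (\<lambda>w. (w, [])) ` words (Suc n) \<union>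
     (case n of 0 \<Rightarrow> {} | Suc n' \<Rightarrow>
        map_prod (\<lambda>a. map Suc a @ [0]) (\<lambda>a. map Suc a @ [0]) ` word_pairs n')"
  (is "?L = ?R")
proof
  show "?L \<subseteq> ?R"
  proof
    fix q assume "q \<in> ?L"
    then obtain a b where q: "q = (a, b)" and sl: "slow a" "slow b"
      and cnt: "\<And>v. count_list a v + count_list b v \<le> 2" and len: "length a + length b = Suc n"
      by (auto simp: word_pairs_def)
    show "q \<in> ?R"
    proof (cases "a = [] \<or> b = []")
      case True
      then show ?thesis using q sl cnt len by (auto simp: words_def)
    next
      case False
      have "count_list a 0 \<noteq> 0" "count_list b 0 \<noteq> 0"
        using False slow_zero_mem sl by (auto simp: count_list_0_iff)
      then have "count_list a 0 \<le> 1" "count_list b 0 \<le> 1" using cnt[of 0] by auto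
      then obtain a' b' where a': "a = map Suc a' @ [0]" "slow a'" and b': "b = map Suc b' @ [0]" "slow b'"
        using slow_single_zero sl False by metis
      then obtain n' where n: "n = Suc n'" "length a' + length b' = n'" using len by (cases n) auto
      have "count_list a' v + count_list b' v \<le> 2" for v
        using cnt[of "Suc v"] a' b' by (simp add: count_map_Suc)
      then have "(a', b') \<in> word_pairs n'" using a' b' n by (simp add: word_pairs_def)
      then show ?thesis using q a' b' n by (force simp: map_prod_def)
    qed
  qed
  show "?R \<subseteq> ?L"
    by (auto simp: words_def word_pairs_def slow_map_Suc_append count_map_Suc split: nat.splits)
qed

lemma set_slow: "slow w \<Longrightarrow> set w \<subseteq> {..<length w}"
proof (induction w)
  case (Cons v u)
  then show ?case using top_le_length[of u] by auto
qed simp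

lemma finite_words: "finite (words n)"
proof (rule finite_subset)
  show "words n \<subseteq> {w. set w \<subseteq> {..<n} \<and> length w = n}"
    using set_slow by (auto simp: words_def)
qed (simp add: finite_lists_length_eq)

lemma finite_word_pairs: "finite (word_pairs n)"
proof (rule finite_subset)
  show "word_pairs n \<subseteq> (\<Union>i\<le>n. words i) \<times> (\<Union>i\<le>n. words i)"
    by (auto simp: word_pairs_def words_def intro: add_leD1 add_leD2)
qed (simp add: finite_words)

definition num_words :: "nat \<Rightarrow> int" where
  "num_words n = int (card (words n))"

definition num_pairs :: "nat \<Rightarrow> int" where
  "num_pairs n = int (card (word_pairs n))"

lemma map_Suc_append_eq_iff:
  "map Suc a @ 0 # b = map Suc a' @ 0 # b' \<longleftrightarrow> a = a' \<and> b = b'"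
proof (induction a arbitrary: a')
  case Nil
  then show ?case by (cases a') auto
next
  case (Cons x a)
  then show ?case by (cases a') auto
qed

lemma num_words_Suc_Suc: "num_words (Suc (Suc n)) = num_words (Suc n) + num_pairs n"
proof -
  have "inj_on (\<lambda>a. map Suc a @ [0]) (words (Suc n))"
    by (auto simp: inj_on_def)
  moreover have "inj_on (\<lambda>(a, c). map Suc a @ 0 # map Suc c @ [0]) (word_pairs n)"
    by (auto simp: inj_on_def map_Suc_append_eq_iff)
  moreover have "(\<lambda>a. map Suc a @ [0]) ` words (Suc n) \<inter>
     (\<lambda>(a, c). map Suc a @ 0 # map Suc c @ [0]) ` word_pairs n = {}"
    by (auto simp: map_Suc_append_eq_iff)
  ultimately show ?thesis
    by (simp add: num_words_def num_pairs_def words_Suc_Suc card_Un_disjoint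
        finite_words finite_word_pairs card_image)
qed

lemma num_pairs_Suc:
  "num_pairs (Suc n) = 2 * num_words (Suc n) + (case n of 0 \<Rightarrow> 0 | Suc n' \<Rightarrow> num_pairs n')"
proof -
  let ?A = "Pair ([] :: nat list) ` words (Suc n)" and ?B = "(\<lambda>w. (w, [] :: nat list)) ` words (Suc n)"
  let ?f = "map_prod (\<lambda>a. map Suc a @ [0]) (\<lambda>a. map Suc a @ [0])"
  let ?C = "case n of 0 \<Rightarrow> {} | Suc n' \<Rightarrow> ?f ` word_pairs n'"
  have AB: "?A \<inter> ?B = {}" by (auto simp: words_def)
  have ABC: "(?A \<union> ?B) \<inter> ?C = {}" by (auto split: nat.splits)
  have C: "finite ?C" by (auto simp: finite_word_pairs split: nat.splits)
  have "inj_on ?f X" for X by (auto simp: inj_on_def)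
  then have cC: "int (card ?C) = (case n of 0 \<Rightarrow> 0 | Suc n' \<Rightarrow> num_pairs n')"
    by (auto simp: num_pairs_def card_image split: nat.splits)
  have "card ?A = card (words (Suc n))" "card ?B = card (words (Suc n))"
    by (auto intro!: card_image simp: inj_on_def)
  then have "int (card (?A \<union> ?B)) = 2 * num_words (Suc n)"
    unfolding num_words_def by (subst card_Un_disjoint[OF _ _ AB]) (simp_all add: finite_words)
  then show ?thesis
    unfolding num_pairs_def[of "Suc n"] word_pairs_Suc
    using ABC C cC by (simp add: card_Un_disjoint finite_words)
qed

lemma num_words_0: "num_words 0 = 1"
  and num_words_1: "num_words (Suc 0) = 1"
  and num_pairs_0: "num_pairs 0 = 1"
  by (simp_all add: num_words_def num_pairs_def words_0 words_1 word_pairs_0)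

text \<open>The pair counts are eliminated by subtracting the word recurrence at distance two, because
  \<open>num_pairs (m + 2) - num_pairs m\<close> is a word count.\<close>

lemma num_words_recurrence:
  "num_words (n + 3) = num_words (n + 2) + 3 * num_words (n + 1) - num_words n"
proof (cases n)
  case 0
  then show ?thesis
    using num_words_Suc_Suc[of 1] num_words_Suc_Suc[of 0] num_pairs_Suc[of 0]
      num_words_0 num_words_1 num_pairs_0
    by (simp add: eval_nat_numeral)
next
  case (Suc m)
  have "num_words (m + 4) = num_words (m + 3) + num_pairs (m + 2)"
    using num_words_Suc_Suc[of "m + 2"] by (simp add: eval_nat_numeral)
  moreover have "num_words (m + 2) = num_words (m + 1) + num_pairs m"
    using num_words_Suc_Suc[of m] by simp
  moreover have "num_pairs (m + 2) = 2 * num_words (m + 2) + num_pairs m"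
    using num_pairs_Suc[of "Suc m"] by simp
  ultimately show ?thesis using Suc by (simp add: eval_nat_numeral)
qed

section \<open>The solitaire on multisets and its inverse branches\<close>

definition play :: "nat multiset \<Rightarrow> nat multiset" where
  "play X = filter_mset (\<lambda>x. 0 < x) (add_mset (size X) (image_mset (\<lambda>x. x - 1) X))"

text \<open>The only candidate for a predecessor of \<open>Y\<close> with \<open>q\<close> parts: the part \<open>q\<close> of \<open>Y\<close> is the one created by
  the move, and the ones that vanished in it are restored to make the number of parts \<open>q\<close>.\<close>

definition unplay :: "nat \<Rightarrow> nat multiset \<Rightarrow> nat multiset" where
  "unplay q Y = image_mset Suc (Y - {#q#}) + replicate_mset (Suc q - size Y) 1"

lemma zero_notin_play: "0 \<notin># play X"
  unfolding play_def set_mset_filter by simp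

lemma zero_notin_play_funpow: "0 \<notin># X \<Longrightarrow> 0 \<notin># (play ^^ i) X"
  by (induction i) (simp_all add: zero_notin_play)

lemma sum_play: "0 \<notin># X \<Longrightarrow> \<Sum>\<^sub># (play X) = \<Sum>\<^sub># X"
proof -
  have f: "\<Sum>\<^sub># (filter_mset (\<lambda>x. 0 < x) Z) = \<Sum>\<^sub># Z" for Z :: "nat multiset"
    by (induction Z) auto
  have "0 \<notin># X \<Longrightarrow> size X + \<Sum>\<^sub># (image_mset (\<lambda>x. x - 1) X) = \<Sum>\<^sub># X"
    by (induction X) auto
  then show "0 \<notin># X \<Longrightarrow> \<Sum>\<^sub># (play X) = \<Sum>\<^sub># X"
    unfolding play_def f by simp
qed

lemma sum_play_funpow: "0 \<notin># X \<Longrightarrow> \<Sum>\<^sub># ((play ^^ i) X) = \<Sum>\<^sub># X"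
  by (induction i) (auto simp: sum_play zero_notin_play_funpow)

lemma unplay_size:
  assumes "q \<in># Y" "size Y \<le> Suc q"
  shows "size (unplay q Y) = q"
proof -
  obtain Z where "Y = add_mset q Z" using assms(1) by (metis insert_DiffM)
  then show ?thesis using assms by (simp add: unplay_def)
qed

lemma zero_notin_unplay: "0 \<notin># unplay q Y"
  by (auto simp: unplay_def)

lemma play_unplay:
  assumes "q \<in># Y" "size Y \<le> Suc q" "0 \<notin># Y"
  shows "play (unplay q Y) = Y"
proof -
  obtain Z where Z: "Y = add_mset q Z" using assms(1) by (metis insert_DiffM)
  have "filter_mset (\<lambda>x. 0 < x) Z = Z"
    using assms(3) Z by (auto simp: filter_mset_eq_conv intro!: Nat.gr0I)
  moreover have "0 < q" using assms(3) Z by (cases q) auto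
  ultimately show ?thesis
    using unplay_size[OF assms(1,2)] Z
    by (simp add: play_def unplay_def multiset.map_comp o_def)
qed

lemma size_play_le: "size (play X) \<le> Suc (size X)"
  unfolding play_def by (metis size_filter_mset_lesseq size_add_mset size_image_mset)

lemma size_mem_play: "X \<noteq> {#} \<Longrightarrow> size X \<in># play X"
  by (simp add: play_def nonempty_has_size)

text \<open>A positive multiset is recovered from its image because the size of the multiset is the part created by
  the move, and the only other information lost is the number of ones, which the size determines.\<close>

lemma unplay_play:
  assumes "0 \<notin># X" "X \<noteq> {#}"
  shows "unplay (size X) (play X) = X"
proof -
  define W where "W X = filter_mset (\<lambda>x. 0 < x) (image_mset (\<lambda>x. x - 1) X)" for X :: "nat multiset"
  have "size (W X) \<le> size X" for X
    unfolding W_def by (metis size_filter_mset_lesseq size_image_mset)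
  then have "image_mset Suc (W X) + replicate_mset (size X - size (W X)) 1 = X"
    using assms(1) by (induction X) (auto simp: W_def Suc_diff_le)
  moreover have "play X = add_mset (size X) (W X)"
    using assms(2) by (simp add: play_def W_def nonempty_has_size)
  ultimately show ?thesis by (simp add: unplay_def)
qed

section \<open>The two recurrent multisets\<close>

primrec cycB :: "nat \<Rightarrow> nat list" where
  "cycB 0 = []"
| "cycB (Suc k) = (2 * k + 1) # (2 * k + 1) # cycB k"

text \<open>The clause for \<open>0\<close> is a dummy value: only for positive \<open>k\<close> does the cycle contain this list.\<close>

primrec cycA :: "nat \<Rightarrow> nat list" where
  "cycA 0 = []"
| "cycA (Suc k) = (2 * k + 2) # map Suc (cycB k)"

lemma length_cycB: "length (cycB k) = 2 * k"
  by (induction k) auto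

lemma set_cycB: "x \<in> set (cycB k) \<Longrightarrow> 0 < x \<and> x < 2 * k"
  by (induction k) auto

text \<open>The part of \<open>cycB k\<close> that the letter \<open>v\<close> stands for, i.e. its \<open>v\<close>-th largest part size counted from \<open>0\<close>.\<close>

definition slot :: "nat \<Rightarrow> nat \<Rightarrow> nat" where
  "slot k v = 2 * (k - v) - 1"

lemma slot_Suc_Suc: "slot (Suc k) (Suc v) = slot k v"
  by (simp add: slot_def)

lemma slot_0: "slot (Suc k) 0 = 2 * k + 1"
  by (simp add: slot_def)

lemma slot_eq: "v < k \<Longrightarrow> slot k v + 2 * v + 1 = 2 * k"
  by (simp add: slot_def)

lemma slot_eq_iff: "v < k \<Longrightarrow> v' < k \<Longrightarrow> slot k v = slot k v' \<longleftrightarrow> v = v'"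
  by (auto simp: slot_def)

lemma count_cycB: "v < k \<Longrightarrow> count (mset (cycB k)) (slot k v) = 2"
proof (induction k arbitrary: v)
  case (Suc k)
  show ?case
  proof (cases v)
    case 0
    have "2 * k + 1 \<notin> set (cycB k)" using set_cycB[of "2 * k + 1" k] by auto
    with 0 show ?thesis by (simp add: slot_0 count_eq_zero_iff)
  next
    case (Suc v')
    with Suc.prems have "slot k v' \<noteq> 2 * k + 1" using slot_eq[of v' k] by simp
    then show ?thesis using Suc Suc.IH[of v'] Suc.prems by (simp add: slot_Suc_Suc)
  qed
qed simp

lemma mem_cycB: "y \<in> set (cycB k) \<Longrightarrow> \<exists>v<k. y = slot k v"
proof (induction k)
  case (Suc k)
  show ?case
  proof (cases "y = 2 * k + 1")
    case True
    then show ?thesis by (intro exI[of _ 0]) (simp add: slot_0)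
  next
    case False
    then obtain v where "v < k" "y = slot k v" using Suc by auto
    then show ?thesis by (intro exI[of _ "Suc v"]) (simp add: slot_Suc_Suc)
  qed
qed simp

lemma unplay_cycB: "0 < k \<Longrightarrow> unplay (2 * k - 1) (mset (cycB k)) = mset (cycA k)"
  by (cases k) (simp_all add: unplay_def length_cycB)

lemma play_cycA: "0 < k \<Longrightarrow> play (mset (cycA k)) = mset (cycB k)"
proof -
  assume k: "0 < k"
  then have "2 * k - 1 \<in># mset (cycB k)" by (cases k) auto
  moreover have "0 \<notin># mset (cycB k)" using set_cycB[of 0 k] by auto
  ultimately show ?thesis
    using play_unplay[of "2 * k - 1" "mset (cycB k)"] unplay_cycB[OF k] by (simp add: length_cycB)
qed

lemma play_cycB: "0 < k \<Longrightarrow> play (mset (cycB k)) = mset (cycA k)"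
proof (induction k)
  case (Suc k)
  have "filter_mset (\<lambda>x. 0 < x) (image_mset (\<lambda>x. x - 1) (mset (cycB (Suc k)))) =
        image_mset Suc (mset (cycB k))"
    by (induction k) auto
  then show ?case by (simp add: play_def length_cycB del: image_mset_add_mset)
qed simp

lemma sum_cycB: "sum_list (cycB k) = 2 * k * k"
  by (induction k) auto

text \<open>A predecessor is determined by the part it undoes, and only the largest part \<open>2k - 1\<close> of \<open>cycB k\<close> is large
  enough compared with the number \<open>2k\<close> of parts.\<close>

lemma predecessor_cycB:
  assumes "0 < k" "0 \<notin># X"
  shows "play X = mset (cycB k) \<longleftrightarrow> X = mset (cycA k)"
proof
  assume X: "play X = mset (cycB k)"
  then have ne: "X \<noteq> {#}" using assms by (cases k) (auto simp: play_def)
  have "size X \<in> set (cycB k)" using size_mem_play[OF ne] X by simp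
  moreover have "2 * k \<le> Suc (size X)"
    using size_play_le[of X] X by (simp add: length_cycB)
  ultimately have "size X = 2 * k - 1" using set_cycB[of "size X" k] by auto
  then show "X = mset (cycA k)" using unplay_play[OF assms(2) ne] X unplay_cycB[OF assms(1)] by simp
qed (use play_cycA[OF assms(1)] in simp)

section \<open>Words parametrise the tree above the cycle\<close>

text \<open>Undoing along a word. The part of \<open>cycB k\<close> named by \<open>v\<close> has grown by one in each of the \<open>length u\<close>
  steps made before.\<close>

primrec ancestor :: "nat \<Rightarrow> nat list \<Rightarrow> nat multiset" where
  "ancestor k [] = mset (cycB k)"
| "ancestor k (v # u) = unplay (slot k v + length u) (ancestor k u)"

definition ancestors :: "nat \<Rightarrow> nat \<Rightarrow> nat multiset set" where
  "ancestors k i = {X. 0 \<notin># X \<and> (play ^^ i) X = mset (cycB k)}"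

text \<open>The invariant that makes the choices available after \<open>u\<close> a matter of words alone. The parts larger than
  \<open>length u\<close> are exactly the unused parts of \<open>cycB k\<close>, raised by \<open>length u\<close>; the parts filled in
  later as ones are at most \<open>length u\<close>. The number of parts is the size of the last part undone,
  which is expressed through \<open>reach\<close>, and without subtraction, so that the empty word is covered too.\<close>

definition tracks :: "nat \<Rightarrow> nat list \<Rightarrow> bool" where
  "tracks k u \<longleftrightarrow> 0 \<notin># ancestor k u \<and>
     size (ancestor k u) + 2 * reach u = 2 * k + length u \<and>
     (\<forall>v<k. count (ancestor k u) (slot k v + length u) = 2 - count_list u v) \<and>
     (\<forall>y>length u. y \<in># ancestor k u \<longrightarrow> (\<exists>v<k. y = slot k v + length u))"

lemma tracks_Nil: "tracks k []"
  using set_cycB[of 0 k] by (auto simp: tracks_def length_cycB count_cycB dest: mem_cycB)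

lemma words_Suc_Cons:
  "v # u \<in> words (Suc i) \<longleftrightarrow> u \<in> words i \<and> v \<le> reach u \<and> count_list u v < 2"
proof
  assume w: "v # u \<in> words (Suc i)"
  then have c: "count_list (v # u) x \<le> 2" for x by (simp add: words_def)
  have "count_list u x \<le> 2" for x using c[of x] by (simp split: if_splits)
  moreover have "count_list u v < 2" using c[of v] by simp
  ultimately show "u \<in> words i \<and> v \<le> reach u \<and> count_list u v < 2"
    using w by (simp add: words_def)
qed (auto simp: words_def)

lemma count_image_Suc: "count (image_mset Suc Z) (Suc y) = count Z y"
  by (induction Z) auto

text \<open>The bound on the number of parts required for undoing translates into \<open>v \<le> reach u\<close>, and the availability
  of the part into the bound on the multiplicity of \<open>v\<close>.\<close>

lemma legal_choice:
  assumes "tracks k u" "length u < k" "slow u" "v \<le> reach u" "count_list u v < 2"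
  shows "slot k v + length u \<in># ancestor k u"
    and "size (ancestor k u) \<le> Suc (slot k v + length u)"
proof -
  have v: "v < k" using top_le_length[OF assms(3)] assms by simp
  then have "0 < count (ancestor k u) (slot k v + length u)"
    using assms by (simp add: tracks_def)
  then show "slot k v + length u \<in># ancestor k u" by simp
  show "size (ancestor k u) \<le> Suc (slot k v + length u)"
    using assms slot_eq[OF v] by (simp add: tracks_def)
qed

lemma tracks_Cons:
  assumes tr: "tracks k u" and len: "length u < k" and "slow u" "v \<le> reach u" "count_list u v < 2"
  shows "tracks k (v # u)"
proof -
  let ?q = "slot k v + length u"
  note legal = legal_choice[OF assms]
  have v: "v < k" using top_le_length[OF assms(3)] assms by simp
  have "size (ancestor k (v # u)) = ?q" using unplay_size[OF legal] by simp
  moreover have "count (ancestor k (v # u)) (slot k v' + length (v # u))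
      = 2 - count_list (v # u) v'" if "v' < k" for v'
  proof -
    let ?y = "slot k v' + length u"
    have "Suc ?y \<noteq> 1" using slot_eq[OF that] by presburger
    then have "count (ancestor k (v # u)) (Suc ?y) = count (ancestor k u - {#?q#}) ?y"
      by (simp only: ancestor.simps unplay_def count_union count_image_Suc count_replicate_mset
          if_False add_0_right)
    moreover have "?y = ?q \<longleftrightarrow> v' = v" using slot_eq_iff[OF that v] by auto
    ultimately show ?thesis using tr that by (auto simp: tracks_def)
  qed
  moreover have "\<exists>v'<k. y = slot k v' + length (v # u)"
    if ly: "length (v # u) < y" and y: "y \<in># ancestor k (v # u)" for y
  proof -
    obtain y' where y': "y = Suc y'" "length u < y'" using ly by (cases y) auto
    then have "y' \<in># ancestor k u"
      using y by (auto simp: unplay_def split: if_splits dest: in_diffD)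
    then obtain v' where "v' < k" "y' = slot k v' + length u"
      using tr y'(2) unfolding tracks_def by blast
    then show ?thesis using y'(1) by auto
  qed
  ultimately show ?thesis
    unfolding tracks_def using slot_eq[OF v] zero_notin_unplay by simp
qed

lemma tracks_words: "i \<le> k \<Longrightarrow> u \<in> words i \<Longrightarrow> tracks k u"
proof (induction i arbitrary: u)
  case 0
  then show ?case by (simp add: words_0 tracks_Nil)
next
  case (Suc i)
  obtain v w where u: "u = v # w" using Suc.prems by (cases u) (auto simp: words_def)
  then show ?case
    using Suc words_Suc_Cons[of v w i] by (auto intro!: tracks_Cons simp: words_def)
qed

text \<open>The bound \<open>i \<le> k\<close> guarantees that a part that can be undone within the first \<open>i\<close> steps is larger than
  the number of steps made so far, so it stems from \<open>cycB k\<close> and is named by a letter.\<close>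

lemma bij_betw_ancestor: "i \<le> k \<Longrightarrow> bij_betw (ancestor k) (words i) (ancestors k i)"
proof (induction i)
  case 0
  then show ?case
    using set_cycB[of 0 k] by (auto simp: words_0 ancestors_def bij_betw_def)
next
  case (Suc i)
  have IH: "bij_betw (ancestor k) (words i) (ancestors k i)" using Suc by simp
  have ik: "i < k" using Suc.prems by simp
  have ancestors_Suc: "ancestors k (Suc i) = {X. 0 \<notin># X \<and> play X \<in> ancestors k i}"
    by (auto simp: ancestors_def funpow_Suc_right zero_notin_play simp del: funpow.simps)
  have ext: "play (ancestor k (v # u)) = ancestor k u"
      "size (ancestor k (v # u)) = slot k v + i" "v < k" "u \<in> words i"
    if "v # u \<in> words (Suc i)" for v u
  proof -
    have u: "u \<in> words i" "v \<le> reach u" "count_list u v < 2" "slow u" "length u = i"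
      using that words_Suc_Cons by (auto simp: words_def)
    have tr: "tracks k u" using tracks_words[of i k u] u ik by simp
    note legal = legal_choice[OF tr _ u(4,2,3)]
    show "play (ancestor k (v # u)) = ancestor k u"
      using play_unplay[OF legal] tr ik u(5) by (simp add: tracks_def)
    show "size (ancestor k (v # u)) = slot k v + i"
      using unplay_size[OF legal] ik u(5) by simp
    show "v < k" using top_le_length[OF u(4)] u ik by simp
    show "u \<in> words i" by fact
  qed
  show ?case unfolding bij_betw_def
  proof
    show "inj_on (ancestor k) (words (Suc i))"
    proof (rule inj_onI)
      fix w w' assume w: "w \<in> words (Suc i)" and w': "w' \<in> words (Suc i)"
        and eq: "ancestor k w = ancestor k w'"
      obtain v u where vu: "w = v # u" using w by (cases w) (auto simp: words_def)
      obtain v' u' where vu': "w' = v' # u'" using w' by (cases w') (auto simp: words_def)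
      note e = ext[OF w[unfolded vu]] and e' = ext[OF w'[unfolded vu']]
      have "ancestor k u = ancestor k u'" using e(1) e'(1) eq vu vu' by simp
      then have "u = u'" using IH e(4) e'(4) by (auto simp: bij_betw_def inj_on_def)
      moreover have "v = v'" using e(2,3) e'(2,3) eq vu vu' slot_eq_iff by simp
      ultimately show "w = w'" using vu vu' by simp
    qed
    show "ancestor k ` words (Suc i) = ancestors k (Suc i)"
    proof
      show "ancestor k ` words (Suc i) \<subseteq> ancestors k (Suc i)"
      proof
        fix X assume "X \<in> ancestor k ` words (Suc i)"
        then obtain w where w: "w \<in> words (Suc i)" and X: "X = ancestor k w" by blast
        obtain v u where vu: "w = v # u" using w by (cases w) (auto simp: words_def)
        have "play X \<in> ancestors k i"
          using ext[OF w[unfolded vu]] X vu IH by (auto simp: bij_betw_def)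
        moreover have "0 \<notin># X" using X vu zero_notin_unplay by simp
        ultimately show "X \<in> ancestors k (Suc i)" by (simp add: ancestors_Suc)
      qed
      show "ancestors k (Suc i) \<subseteq> ancestor k ` words (Suc i)"
      proof
        fix X assume "X \<in> ancestors k (Suc i)"
        then have X0: "0 \<notin># X" and "play X \<in> ancestors k i" by (auto simp: ancestors_Suc)
        then obtain u where u: "u \<in> words i" and pX: "play X = ancestor k u"
          using IH by (auto simp: bij_betw_def)
        have lu: "length u = i" "slow u" using u by (auto simp: words_def)
        have tr: "tracks k u" using tracks_words[of i k u] u ik by simp
        have tu: "reach u \<le> i" using top_le_length[OF lu(2)] lu by simp
        have sz: "size (ancestor k u) + 2 * reach u = 2 * k + i"
          using tr lu by (simp add: tracks_def)
        have ne: "X \<noteq> {#}" using pX sz tu ik by (auto simp: play_def)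
        have mem: "size X \<in># ancestor k u" using size_mem_play[OF ne] pX by simp
        have le: "size (ancestor k u) \<le> Suc (size X)" using size_play_le[of X] pX by simp
        \<comment> \<open>The part undone is too large to have been filled in as a one.\<close>
        have "i < size X" using le sz tu ik by linarith
        then obtain v where v: "v < k" "size X = slot k v + i"
          using tr mem lu unfolding tracks_def by blast
        have "0 < count (ancestor k u) (slot k v + i)" using mem v by simp
        moreover have "count (ancestor k u) (slot k v + i) = 2 - count_list u v"
          using tr v(1) lu(1) by (simp add: tracks_def)
        ultimately have "count_list u v < 2" by simp
        moreover have "v \<le> reach u" using v(2) sz le slot_eq[OF v(1)] by linarith
        ultimately have "v # u \<in> words (Suc i)" using u by (simp add: words_Suc_Cons)
        moreover have "ancestor k (v # u) = X"
          using unplay_play[OF X0 ne] pX v lu by simp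
        ultimately show "X \<in> ancestor k ` words (Suc i)" by force
      qed
    qed
  qed
qed

lemma card_ancestors: "i \<le> k \<Longrightarrow> int (card (ancestors k i)) = num_words i"
  using bij_betw_same_card[OF bij_betw_ancestor] by (simp add: num_words_def)

lemma finite_ancestors: "i \<le> k \<Longrightarrow> finite (ancestors k i)"
  using bij_betw_finite[OF bij_betw_ancestor] by (simp add: finite_words)

lemma ancestors_eq_cycA:
  assumes "0 < k"
  shows "ancestors k (Suc i) = {X. 0 \<notin># X \<and> (play ^^ i) X = mset (cycA k)}"
  using predecessor_cycB[OF assms zero_notin_play_funpow] by (auto simp: ancestors_def)

lemma cycA_ne_cycB: "0 < k \<Longrightarrow> mset (cycA k) \<noteq> mset (cycB k)"
proof
  assume "0 < k" "mset (cycA k) = mset (cycB k)"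
  moreover have "2 * k \<in># mset (cycA k)" using \<open>0 < k\<close> by (cases k) auto
  ultimately have "2 * k \<in># mset (cycB k)" by simp
  then show False using set_cycB[of "2 * k" k] by simp
qed

definition low_levels :: "nat \<Rightarrow> nat \<Rightarrow> nat multiset set" where
  "low_levels k i = {X. 0 \<notin># X \<and> (play ^^ i) X \<in> {mset (cycA k), mset (cycB k)}}"

text \<open>Reaching \<open>cycA k\<close> after \<open>i\<close> moves means reaching \<open>cycB k\<close> after \<open>i + 1\<close> moves, as \<open>cycA k\<close> is the only
  predecessor of \<open>cycB k\<close>. The two possibilities exclude each other since the parts differ.\<close>

lemma card_low_levels:
  assumes "0 < k" "Suc i \<le> k"
  shows "int (card (low_levels k i)) = num_words i + num_words (Suc i)"
proof -
  have "low_levels k i = ancestors k i \<union> ancestors k (Suc i)"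
    unfolding ancestors_eq_cycA[OF assms(1)] by (auto simp: low_levels_def ancestors_def)
  moreover have "ancestors k i \<inter> ancestors k (Suc i) = {}"
    unfolding ancestors_eq_cycA[OF assms(1)] using cycA_ne_cycB[OF assms(1)]
    by (auto simp: ancestors_def)
  ultimately show ?thesis
    using assms by (simp add: card_Un_disjoint finite_ancestors card_ancestors)
qed

text \<open>Monotonicity holds because the move exchanges the two members of the cycle.\<close>

lemma low_levels_mono: "0 < k \<Longrightarrow> low_levels k i \<subseteq> low_levels k (Suc i)"
  by (auto simp: low_levels_def play_cycA play_cycB)

section \<open>Lists as multisets\<close>

lemma sorted_ge_iff: "sorted_wrt (\<ge>) xs \<longleftrightarrow> sorted (rev xs)" for xs :: "nat list"
  by (simp add: sorted_wrt_rev)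

lemma sorted_ge_mset_inj:
  fixes xs ys :: "nat list"
  assumes "sorted_wrt (\<ge>) xs" "sorted_wrt (\<ge>) ys" "mset xs = mset ys"
  shows "xs = ys"
proof -
  have "sort (rev xs) = rev ys"
    using assms by (intro properties_for_sort) (simp_all add: sorted_ge_iff)
  moreover have "sort (rev xs) = rev xs"
    using assms(1) by (intro properties_for_sort) (simp_all add: sorted_ge_iff)
  ultimately show ?thesis by simp
qed

lemma bij_betw_mset_partitions: "bij_betw mset (partitions n) {X. 0 \<notin># X \<and> \<Sum>\<^sub># X = n}"
  unfolding bij_betw_def
proof
  show "inj_on mset (partitions n)"
    by (rule inj_onI) (simp add: partitions_def sorted_ge_mset_inj)
  show "mset ` partitions n = {X. 0 \<notin># X \<and> \<Sum>\<^sub># X = n}"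
  proof
    show "mset ` partitions n \<subseteq> {X. 0 \<notin># X \<and> \<Sum>\<^sub># X = n}"
      by (auto simp: partitions_def sum_mset_sum_list)
    show "{X. 0 \<notin># X \<and> \<Sum>\<^sub># X = n} \<subseteq> mset ` partitions n"
    proof
      fix X :: "nat multiset" assume X: "X \<in> {X. 0 \<notin># X \<and> \<Sum>\<^sub># X = n}"
      have ms: "mset (rev (sorted_list_of_multiset X)) = X" by simp
      have "sum_list (rev (sorted_list_of_multiset X)) = n"
        using X unfolding sum_mset_sum_list[symmetric] ms by simp
      then have "rev (sorted_list_of_multiset X) \<in> partitions n"
        using X by (auto simp: partitions_def sorted_ge_iff intro!: Nat.gr0I)
      then show "X \<in> mset ` partitions n" using ms by (metis imageI)
    qed
  qed
qed

lemma mset_bulgarian: "mset (bulgarian xs) = play (mset xs)"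
  by (simp add: bulgarian_def play_def)

lemma mset_bulgarian_funpow: "mset ((bulgarian ^^ i) xs) = (play ^^ i) (mset xs)"
  by (induction i) (simp_all add: mset_bulgarian)

lemma bulgarian_partitions:
  assumes "xs \<in> partitions n"
  shows "bulgarian xs \<in> partitions n"
proof -
  have "0 \<notin> set xs" using assms by (auto simp: partitions_def)
  then have "sum_list (bulgarian xs) = n"
    using sum_play[of "mset xs"] assms
    unfolding mset_bulgarian[symmetric] sum_mset_sum_list by (simp add: partitions_def)
  then show ?thesis
    by (auto simp: partitions_def bulgarian_def sorted_ge_iff)
qed

lemma bulgarian_funpow_partitions: "xs \<in> partitions n \<Longrightarrow> (bulgarian ^^ i) xs \<in> partitions n"
  by (induction i) (simp_all add: bulgarian_partitions)

lemma finite_partitions: "finite (partitions n)"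
proof (rule finite_subset)
  have "length xs \<le> sum_list xs" if "\<forall>x\<in>set xs. 0 < x" for xs :: "nat list"
    using that by (induction xs) auto
  then show "partitions n \<subseteq> {xs. set xs \<subseteq> {..n} \<and> length xs \<le> n}"
    by (auto simp: partitions_def member_le_sum_list)
qed (simp add: finite_lists_length_le)

section \<open>The alternating necklace\<close>

abbreviation alternating :: "nat \<Rightarrow> necklace" where
  "alternating k \<equiv> necklace_of_word (word_power [Black, White] k)"

lemma word_power_Suc: "word_power P (Suc k) = P @ word_power P k"
  by (simp add: word_power_def)

lemma word_power_0: "word_power P 0 = []"
  by (simp add: word_power_def)

lemma word_power_pair_snoc: "word_power [a, b] k @ [a] = a # word_power [b, a] k"
  by (induction k) (simp_all add: word_power_Suc word_power_0)

lemma rotate1_word_power_pair: "rotate1 (word_power [a, b] k) = word_power [b, a] k"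
  by (cases k) (simp_all add: word_power_Suc word_power_0 word_power_pair_snoc)

text \<open>Rotating by one place exchanges the two alternating words, so the class has no other members.\<close>

lemma word_of_alternating:
  "necklace_of_word w = alternating k \<longleftrightarrow>
     w = word_power [Black, White] k \<or> w = word_power [White, Black] k"
proof -
  have r: "rotate i (word_power [Black, White] k) \<in>
      {word_power [Black, White] k, word_power [White, Black] k}" for i
    by (induction i) (auto simp: rotate1_word_power_pair)
  have "necklace_of_word w = alternating k \<longleftrightarrow> rotation_equiv (word_power [Black, White] k) w"
    using necklace.abs_eq_iff rotation_equiv_sym by blast
  also have "\<dots> \<longleftrightarrow> w = word_power [Black, White] k \<or> w = word_power [White, Black] k"
  proof
    assume "rotation_equiv (word_power [Black, White] k) w"
    then show "w = word_power [Black, White] k \<or> w = word_power [White, Black] k"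
      using r by (auto simp: rotation_equiv_def)
  next
    have "word_power [Black, White] k = rotate 0 (word_power [Black, White] k)"
      "word_power [White, Black] k = rotate 1 (word_power [Black, White] k)"
      by (simp_all add: rotate1_word_power_pair)
    moreover assume "w = word_power [Black, White] k \<or> w = word_power [White, Black] k"
    ultimately show "rotation_equiv (word_power [Black, White] k) w"
      unfolding rotation_equiv_def by metis
  qed
  finally show ?thesis .
qed

lemma length_alternating: "necklace_length (alternating k) = 2 * k"
proof -
  have "length (word_power [Black, White] k) = 2 * k"
    by (induction k) (simp_all add: word_power_Suc word_power_0)
  then show ?thesis by (simp add: necklace_length.abs_eq)
qed

lemma weight_alternating: "necklace_weight (alternating k) = 2 * k * k"
proof -
  have "count_list (word_power [Black, White] k) Black = k"
    by (induction k) (simp_all add: word_power_Suc word_power_0)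
  then have "black_beads (alternating k) = k" by (simp add: black_beads.abs_eq)
  moreover have "((2 * k) choose 2) + k = 2 * k * k"
    by (cases k) (simp_all add: choose_two)
  ultimately show ?thesis by (simp add: necklace_weight_def length_alternating)
qed

abbreviation excess :: "nat list \<Rightarrow> nat \<Rightarrow> int list" where
  "excess xs m \<equiv> map2 (\<lambda>a s. int a - int s) xs (rev [0..<m])"

lemma excess_inj:
  assumes "excess xs m = excess ys m" "length xs = m" "length ys = m"
  shows "xs = ys"
proof (rule nth_equalityI)
  fix i assume i: "i < length xs"
  have "excess xs m ! i = excess ys m ! i" using assms(1) by simp
  then show "xs ! i = ys ! i" using i assms(2,3) by simp
qed (use assms in simp)

lemma rev_upt_double_Suc: "rev [0..<2 * Suc k] = Suc (2 * k) # 2 * k # rev [0..<2 * k]"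
  by simp

text \<open>Raising \<open>k\<close> by one puts two entries in front of both the partition and the staircase, and their
  differences are the next two letters of the alternating word.\<close>

lemma excess_cycB: "excess (cycB k) (2 * k) = map bead_digit (word_power [White, Black] k)"
proof (induction k)
  case (Suc k)
  then show ?case
    unfolding rev_upt_double_Suc by (simp add: word_power_Suc bead_digit_def)
qed (simp add: word_power_0)

lemma excess_cycA:
  "0 < k \<Longrightarrow> excess (cycA k @ [0]) (2 * k) = map bead_digit (word_power [Black, White] k)"
proof (induction k)
  case (Suc k)
  show ?case
  proof (cases k)
    case 0
    then show ?thesis by (simp add: word_power_Suc word_power_0 bead_digit_def upt_rec)
  next
    case (Suc k')
    then have "cycA (Suc k) @ [0] = (2 * k + 2) # (2 * k) # cycA k @ [0]" by simp
    then show ?thesis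
      using Suc.IH Suc unfolding rev_upt_double_Suc
      by (simp add: word_power_Suc bead_digit_def del: cycA.simps)
  qed
qed simp

lemma length_cycA: "0 < k \<Longrightarrow> length (cycA k) + 1 = 2 * k"
  by (cases k) (simp_all add: length_cycB)

lemma sorted_cycB: "sorted_wrt (\<ge>) (cycB k)"
proof (induction k)
  case (Suc k)
  then show ?case using set_cycB[of _ k] by (auto intro: less_imp_le less_SucI)
qed simp

lemma sorted_cycA: "sorted_wrt (\<ge>) (cycA k)"
proof (cases k)
  case (Suc k')
  have "sorted_wrt (\<ge>) (map Suc (cycB k'))" using sorted_cycB by (simp add: sorted_wrt_map)
  then show ?thesis using Suc set_cycB[of _ k'] by fastforce
qed simp

lemma sum_cycA: "0 < k \<Longrightarrow> sum_list (cycA k) = 2 * k * k"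
  using sum_play[of "mset (cycB k)"] play_cycB[of k] set_cycB[of 0 k] sum_cycB[of k]
  by (metis bot_nat_0.not_eq_extremum set_mset_mset sum_mset_sum_list)

lemma cyc_partitions:
  assumes "0 < k"
  shows "cycA k \<in> partitions (2 * k * k)" "cycB k \<in> partitions (2 * k * k)"
proof -
  have "0 \<notin> set (cycA k)" by (cases k) auto
  then show "cycA k \<in> partitions (2 * k * k)"
    using sorted_cycA sum_cycA[OF assms] by (auto simp: partitions_def intro!: Nat.gr0I)
  show "cycB k \<in> partitions (2 * k * k)"
    using sorted_cycB sum_cycB set_cycB by (auto simp: partitions_def)
qed

text \<open>Padding is undone by discarding the zeros.\<close>

lemma pad_zeros_inj:
  assumes "pad_zeros m xs = ys @ replicate j 0" "xs \<in> partitions n" "ys \<in> partitions n"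
  shows "xs = ys"
proof -
  have "filter (\<lambda>x. 0 < x) (zs @ replicate l 0) = zs" if "zs \<in> partitions n" for zs l
    using that by (auto simp: partitions_def filter_replicate)
  then show ?thesis using assms unfolding pad_zeros_def by metis
qed

lemma recurrent_cycle_alternating:
  assumes "0 < k"
  shows "recurrent_cycle (alternating k) = {cycA k, cycB k}"
proof
  let ?n = "2 * k * k" and ?m = "2 * k"
  have padA: "pad_zeros ?m (cycA k) = cycA k @ [0]"
  proof -
    have "?m - length (cycA k) = 1" using length_cycA[OF assms] by linarith
    then show ?thesis by (simp add: pad_zeros_def)
  qed
  have padB: "pad_zeros ?m (cycB k) = cycB k"
    by (simp add: pad_zeros_def length_cycB)
  have enc: "encodes (excess zs ?m) (alternating k) \<longleftrightarrow>
      excess zs ?m = excess (cycA k @ [0]) ?m \<or> excess zs ?m = excess (cycB k) ?m" for zs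
    unfolding encodes_def word_of_alternating excess_cycA[OF assms] excess_cycB by blast
  show "recurrent_cycle (alternating k) \<subseteq> {cycA k, cycB k}"
  proof
    fix xs assume "xs \<in> recurrent_cycle (alternating k)"
    then have xs: "xs \<in> partitions ?n" "length xs \<le> ?m"
      and e: "encodes (excess (pad_zeros ?m xs) ?m) (alternating k)"
      by (simp_all add: recurrent_cycle_def weight_alternating length_alternating)
    have len: "length (pad_zeros ?m xs) = ?m" using xs by (simp add: pad_zeros_def)
    have "pad_zeros ?m xs = cycA k @ [0] \<or> pad_zeros ?m xs = cycB k"
      using e[unfolded enc] excess_inj[OF _ len] length_cycA[OF assms] length_cycB by auto
    then have "pad_zeros ?m xs = cycA k @ replicate 1 0 \<or> pad_zeros ?m xs = cycB k @ replicate 0 0"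
      by simp
    then show "xs \<in> {cycA k, cycB k}"
      using pad_zeros_inj[OF _ xs(1)] cyc_partitions[OF assms] by blast
  qed
  show "{cycA k, cycB k} \<subseteq> recurrent_cycle (alternating k)"
    using cyc_partitions[OF assms] length_cycA[OF assms] length_cycB[of k] padA padB enc
    by (auto simp: recurrent_cycle_def weight_alternating length_alternating)
qed

section \<open>Level generating functions\<close>

lemma coeff_level_poly: "coeff (level_poly N) i = int (card {xs \<in> orbit N. level N xs = i})"
proof -
  have fin: "finite (orbit N)"
    by (rule finite_subset[OF _ finite_partitions]) (auto simp: orbit_def)
  have "coeff (level_poly N) i = (\<Sum>xs\<in>orbit N. if level N xs = i then 1 else 0)"
    by (simp add: level_poly_def coeff_sum)
  also have "\<dots> = int (card {xs \<in> orbit N. level N xs = i})"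
    using fin by (simp add: sum.If_cases Int_def)
  finally show ?thesis .
qed

definition enters :: "necklace \<Rightarrow> nat \<Rightarrow> nat list set" where
  "enters N i = {xs \<in> partitions (necklace_weight N). (bulgarian ^^ i) xs \<in> recurrent_cycle N}"

text \<open>The sum of the parts is preserved by the move, so every positive multiset that reaches the cycle has
  the weight of the necklace as its sum.\<close>

lemma bij_betw_enters_low_levels:
  assumes "0 < k"
  shows "bij_betw mset (enters (alternating k) i) (low_levels k i)"
proof -
  let ?n = "2 * k * k"
  have inj: "inj_on mset (partitions ?n)" and
    im: "mset ` partitions ?n = {X. 0 \<notin># X \<and> \<Sum>\<^sub># X = ?n}"
    using bij_betw_mset_partitions[of ?n] by (auto simp: bij_betw_def)
  have cyc: "ys = cycA k \<longleftrightarrow> mset ys = mset (cycA k)" "ys = cycB k \<longleftrightarrow> mset ys = mset (cycB k)"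
    if "ys \<in> partitions ?n" for ys
    using that inj cyc_partitions[OF assms] by (auto dest: inj_onD)
  have enters: "enters (alternating k) i = {xs \<in> partitions ?n. mset xs \<in> low_levels k i}"
  proof -
    have "0 \<notin> set xs" if "xs \<in> partitions ?n" for xs using that by (auto simp: partitions_def)
    then show ?thesis
      using cyc[OF bulgarian_funpow_partitions]
      by (auto simp: enters_def weight_alternating recurrent_cycle_alternating[OF assms] low_levels_def
          mset_bulgarian_funpow)
  qed
  have "low_levels k i \<subseteq> mset ` partitions ?n"
  proof
    fix X assume X: "X \<in> low_levels k i"
    then have "\<Sum>\<^sub># X = \<Sum>\<^sub># ((play ^^ i) X)" by (simp add: low_levels_def sum_play_funpow)
    also have "\<dots> = ?n"
      using X sum_cycA[OF assms] sum_cycB[of k] by (auto simp: low_levels_def sum_mset_sum_list)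
    finally show "X \<in> mset ` partitions ?n" using X im by (simp add: low_levels_def)
  qed
  then show ?thesis
    using inj unfolding enters bij_betw_def by (auto intro: inj_on_subset)
qed

text \<open>The differences of consecutive values of \<open>num_words i + num_words (i + 1)\<close>.\<close>

definition level_count :: "nat \<Rightarrow> int" where
  "level_count i = (case i of 0 \<Rightarrow> num_words 0 + num_words 1 | Suc j \<Rightarrow> num_words (j + 2) - num_words j)"

text \<open>As the sets of partitions in the cycle after \<open>i\<close> moves increase with \<open>i\<close>, level at most \<open>i\<close> means being
  in the \<open>i\<close>-th of them.\<close>

lemma coeff_level_poly_alternating:
  assumes "i < k"
  shows "coeff (level_poly (alternating k)) i = level_count i"
proof -
  let ?N = "alternating k"
  have k: "0 < k" using assms by simp
  have image: "mset ` enters ?N j = low_levels k j" for j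
    using bij_betw_enters_low_levels[OF k, of j] by (simp add: bij_betw_def)
  have card: "int (card (enters ?N j)) = num_words j + num_words (Suc j)" if "j \<le> i" for j
  proof -
    have "card (enters ?N j) = card (low_levels k j)"
      by (rule bij_betw_same_card[OF bij_betw_enters_low_levels[OF k]])
    then show ?thesis using card_low_levels[OF k, of j] that assms by simp
  qed
  have mono: "enters ?N j \<subseteq> enters ?N (Suc j)" for j
  proof
    fix xs assume xs: "xs \<in> enters ?N j"
    then have "mset xs \<in> mset ` enters ?N (Suc j)"
      using image low_levels_mono[OF k] by blast
    then obtain ys where ys: "ys \<in> enters ?N (Suc j)" "mset xs = mset ys" by blast
    have "xs = ys"
    proof (rule inj_onD[OF bij_betw_imp_inj_on[OF bij_betw_mset_partitions] ys(2)])
      show "xs \<in> partitions (necklace_weight ?N)" "ys \<in> partitions (necklace_weight ?N)"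
        using xs ys(1) by (simp_all add: enters_def)
    qed
    then show "xs \<in> enters ?N (Suc j)" using ys(1) by simp
  qed
  have mono': "enters ?N j \<subseteq> enters ?N l" if "j \<le> l" for j l
    using that by (induction rule: dec_induct) (use mono in blast)+
  have le: "xs \<in> orbit ?N \<and> level ?N xs \<le> j \<longleftrightarrow> xs \<in> enters ?N j" for xs j
  proof
    assume a: "xs \<in> orbit ?N \<and> level ?N xs \<le> j"
    then obtain l where "(bulgarian ^^ l) xs \<in> recurrent_cycle ?N" by (auto simp: orbit_def)
    then have "(bulgarian ^^ level ?N xs) xs \<in> recurrent_cycle ?N"
      unfolding level_def by (rule LeastI)
    then have "xs \<in> enters ?N (level ?N xs)"
      using a by (simp add: orbit_def enters_def)
    then show "xs \<in> enters ?N j" using mono' a by blast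
  next
    assume a: "xs \<in> enters ?N j"
    then have "level ?N xs \<le> j" unfolding level_def by (intro Least_le) (simp add: enters_def)
    then show "xs \<in> orbit ?N \<and> level ?N xs \<le> j" using a by (auto simp: orbit_def enters_def)
  qed
  have fin: "finite (enters ?N j)" for j
    by (rule finite_subset[OF _ finite_partitions]) (auto simp: enters_def)
  show ?thesis
  proof (cases i)
    case 0
    then have "{xs \<in> orbit ?N. level ?N xs = i} = enters ?N 0" using le[of _ 0] by auto
    then show ?thesis using card[of 0] 0 by (simp add: coeff_level_poly level_count_def)
  next
    case (Suc j)
    have "{xs \<in> orbit ?N. level ?N xs = i} = enters ?N (Suc j) - enters ?N j"
      unfolding set_eq_iff Diff_iff le[symmetric] using Suc by auto
    then show ?thesis
      using card[of j] card[of "Suc j"] Suc fin mono[of j]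
      by (simp add: coeff_level_poly level_count_def card_Diff_subset of_nat_diff card_mono)
  qed
qed

lemma level_count_0: "level_count 0 = num_words 0 + num_words 1"
  and level_count_Suc: "level_count (Suc j) = num_words (j + 2) - num_words j"
  by (simp_all add: level_count_def)

lemma level_count_recurrence:
  "level_count (n + 4) = level_count (n + 3) + 3 * level_count (n + 2) - level_count (n + 1)"
  using num_words_recurrence[of "n + 2"] num_words_recurrence[of n]
    level_count_Suc[of "n + 3"] level_count_Suc[of "n + 2"] level_count_Suc[of "n + 1"] level_count_Suc[of n]
  by (simp add: eval_nat_numeral)

lemma level_count_values:
  "level_count 0 = 2" "level_count 1 = 1" "level_count 2 = 3" "level_count 3 = 7"
  using num_words_0 num_words_1 num_pairs_0 num_words_Suc_Suc[of 0] num_words_recurrence[of 0] num_words_recurrence[of 1]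
    level_count_0 level_count_Suc[of 0] level_count_Suc[of 1] level_count_Suc[of 2]
  by (simp_all add: eval_nat_numeral)

text \<open>Multiplying by the denominator, the recurrence kills all coefficients from \<open>x\<^sup>4\<close> on, and the first four
  values of \<open>level_count\<close> give the numerator.\<close>

lemma generating_function:
  "rat_fps_of_int_fps (Abs_fps level_count) =
      ((fps_X - 1)^2 * (3 * fps_X + 2)) / (fps_X^3 - 3 * fps_X^2 - fps_X + 1)"
proof -
  let ?D = "fps_X^3 - 3 * fps_X^2 - fps_X + 1 :: rat fps"
  let ?H = "rat_fps_of_int_fps (Abs_fps level_count)"
  have "fps_nth ?D 0 \<noteq> 0" by simp
  then have D: "?D \<noteq> 0" by (metis fps_zero_nth)
  have "?H * ?D = fps_X^3 * ?H - fps_const 3 * (fps_X^2 * ?H) - fps_X * ?H + ?H"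
    by (simp add: algebra_simps numeral_fps_const)
  also have "\<dots> = fps_const 3 * fps_X ^ 3 - fps_const 4 * fps_X ^ 2 - fps_X + fps_const 2"
  proof (rule fps_ext)
    fix n :: nat
    have rec: "(of_int (level_count (m + 4)) :: rat) =
        of_int (level_count (3 + m)) + 3 * of_int (level_count (m + 2)) - of_int (level_count (m + 1))" for m
      unfolding level_count_recurrence by (simp add: add.commute)
    consider "n = 0" | "n = 1" | "n = 2" | "n = 3" | m where "n = m + 4"
      by (cases "n < 4") (force, metis add.commute le_Suc_ex not_less)
    then show "fps_nth (fps_X^3 * ?H - fps_const 3 * (fps_X^2 * ?H) - fps_X * ?H + ?H) n =
      fps_nth (fps_const 3 * fps_X ^ 3 - fps_const 4 * fps_X ^ 2 - fps_X + fps_const 2) n"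
      by cases (use level_count_values rec in \<open>simp_all add: rat_fps_of_int_fps_def fps_X_power_mult_nth\<close>)
  qed
  also have "\<dots> = (fps_X - 1)^2 * (3 * fps_X + 2)"
    by (simp add: numeral_fps_const[symmetric] algebra_simps power2_eq_square power3_eq_cube)
  finally show ?thesis using D by (metis nonzero_mult_div_cancel_right)
qed

theorem theorem1p1:
  shows "\<exists>H :: int fps.
    (\<forall>i. (\<lambda>k. coeff (level_poly (necklace_of_word (word_power [Black, White] k))) i)
            \<longlonglongrightarrow> fps_nth H i) \<and>
    rat_fps_of_int_fps H =
      ((fps_X - 1)^2 * (3 * fps_X + 2)) / (fps_X^3 - 3 * fps_X^2 - fps_X + 1) \<and>
    map (fps_nth H) [0..<9] = [2, 1, 3, 7, 15, 33, 71, 155, 335]"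
proof (intro exI conjI allI)
  fix i
  have "eventually (\<lambda>k. coeff (level_poly (alternating k)) i = level_count i) sequentially"
    using eventually_gt_at_top[of i] by eventually_elim (rule coeff_level_poly_alternating)
  then show "(\<lambda>k. coeff (level_poly (alternating k)) i) \<longlonglongrightarrow> fps_nth (Abs_fps level_count) i"
    by (simp add: tendsto_eventually)
next
  show "rat_fps_of_int_fps (Abs_fps level_count) =
      ((fps_X - 1)^2 * (3 * fps_X + 2)) / (fps_X^3 - 3 * fps_X^2 - fps_X + 1)"
    by (rule generating_function)
next
  note rec = level_count_recurrence
  have 4: "level_count 4 = 15"
    using rec[of 0] level_count_values by (simp add: eval_nat_numeral)
  have 5: "level_count 5 = 33"
    using rec[of 1] level_count_values 4 by (simp add: eval_nat_numeral)
  have 6: "level_count 6 = 71"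
    using rec[of 2] level_count_values 4 5 by (simp add: eval_nat_numeral)
  have 7: "level_count 7 = 155"
    using rec[of 3] 4 5 6 by (simp add: eval_nat_numeral)
  have 8: "level_count 8 = 335"
    using rec[of 4] 5 6 7 by (simp add: eval_nat_numeral)
  have "[0..<9] = [0, 1, 2, 3, 4, 5, 6, 7, 8]"
    by (simp add: upt_rec)
  then show "map (fps_nth (Abs_fps level_count)) [0..<9] = [2, 1, 3, 7, 15, 33, 71, 155, 335]"
    using level_count_values 4 5 6 7 8 by simp
qed

end
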